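(* Let $q$ be a prime power and $m,n$ positive integers. Then: (1) for every positive integer $\ell \leq mn$, there exists an $\mathbb{F}_q$-linear code $\mathcal{C} \subsetneqq \mathbb{F}_q^{m \times n}$ whose nested pair $\mathcal{C} \subsetneqq \mathbb{F}_q^{m\times n}$ has information parameter $\ell$ and security parameter $t = \min\{m,n\} - \lceil \ell / \max\{m,n\} \rceil$; (2) for every positive integer $t \leq \min\{m,n\} - 1$, there exists an $\mathbb{F}_q$-linear code $\mathcal{C} \subsetneqq \mathbb{F}_q^{m \times n}$ whose nested pair $\mathcal{C} \subsetneqq \mathbb{F}_q^{m\times n}$ has security parameter $t$ and information parameter $\ell = \max\{m,n\}(\min\{m,n\} - t)$.
   Context: For an $\mathbb{F}_q$-linear code $\mathcal{C} \subsetneqq \mathbb{F}_q^{m \times n}$, the nested pair $\mathcal{C} \subsetneqq \mathbb{F}_q^{m\times n}$ is used as follows: with $\ell = mn - \dim \mathcal{C}$, fix a complement $\mathcal{W}$ with $\mathbb{F}_q^{m\times n} = \mathcal{C} \oplus \mathcal{W}$ and an isomorphism $\psi:\mathbb{F}_q^\ell \to \mathcal{W}$; a uniform message $\mathbf{x} \in \mathbb{F}_q^\ell$ is encoded as $C = \psi(\mathbf{x}) + D$ with $D$ uniform on $\mathcal{C}$, independent of $\mathbf{x}$. The information parameter of the pair is $\ell = mn - \dim(\mathcal{C})$ (equivalently $\dim(\mathcal{C}^\perp)$, where $\mathcal{C}^\perp$ is the dual with respect to $\langle C, D\rangle = {\rm Trace}(CD^T)$). Its security parameter $t$ is the largest integer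 $\mu$ such that the mutual information $I(\mathbf{x}; CB^T) = 0$ for every matrix $B \in \mathbb{F}_q^{\mu \times n}$ (an adversary observing $CB^T$ corresponds to wire-tapping $\mu$ links). *)

theory Defs
  imports "HOL-Analysis.Analysis" "HOL-Probability.Probability"
begin

text \<open>Matrices in F_q^{m x n} are elements of type 'a^'n^'m (m rows indexed by 'm,
  n columns indexed by 'n), with scalar multiplication by field elements entrywise.\<close>

definition mat_scale :: "'a::field \<Rightarrow> 'a^'n^'m \<Rightarrow> 'a^'n^'m" where
  "mat_scale c A = (\<chi> i j. c * A$i$j)"

interpretation mat: vector_space "mat_scale :: 'a::field \<Rightarrow> 'a^'n^'m \<Rightarrow> 'a^'n^'m"
  by unfold_locales (simp_all add: mat_scale_def vec_eq_iff algebra_simps)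

text \<open>F_q^l, represented as lists of length l, with the componentwise operations.\<close>

definition msgs :: "nat \<Rightarrow> 'a list set" where
  "msgs l = {xs. length xs = l}"

definition list_add :: "'a::plus list \<Rightarrow> 'a list \<Rightarrow> 'a list" where
  "list_add xs ys = map2 (+) xs ys"

definition list_scale :: "'a::times \<Rightarrow> 'a list \<Rightarrow> 'a list" where
  "list_scale c xs = map ((*) c) xs"

definition linear_code :: "('a::field^'n^'m) set \<Rightarrow> bool" where
  "linear_code C \<longleftrightarrow> mat.subspace C"

definition info_param :: "('a::field^'n::finite^'m::finite) set \<Rightarrow> nat" where
  "info_param C = CARD('m) * CARD('n) - mat.dim C"

definition is_complement :: "('a::field^'n^'m) set \<Rightarrow> ('a^'n^'m) set \<Rightarrow> bool" where
  "is_complement C W \<longleftrightarrow> mat.subspace W \<and> C \<inter> W = {0} \<and>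
     (\<forall>A. \<exists>c\<in>C. \<exists>w\<in>W. A = c + w)"

definition is_lin_iso :: "nat \<Rightarrow> ('a::field list \<Rightarrow> 'a^'n^'m) \<Rightarrow> ('a^'n^'m) set \<Rightarrow> bool" where
  "is_lin_iso l psi W \<longleftrightarrow> bij_betw psi (msgs l) W \<and>
     (\<forall>x\<in>msgs l. \<forall>y\<in>msgs l. psi (list_add x y) = psi x + psi y) \<and>
     (\<forall>c. \<forall>x\<in>msgs l. psi (list_scale c x) = mat_scale c (psi x))"

text \<open>Mutual information I(x; C B^T), where x is uniform on F^l, D uniform on the code
  (independent), C = psi x + D, and B is a mu x n matrix given by its list of mu rows bs;
  C B^T is given by its list of columns, the k-th column being C *v (k-th row of B).\<close>

definition leakage :: "('a::{finite,field}^'n::finite^'m::finite) set \<Rightarrow> ('a list \<Rightarrow> 'a^'n^'m)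
    \<Rightarrow> ('a^'n) list \<Rightarrow> real" where
  "leakage C psi bs =
     prob_space.mutual_information
       (measure_pmf (pair_pmf (pmf_of_set (msgs (info_param C))) (pmf_of_set C))) 2
       (count_space UNIV) (count_space UNIV)
       fst (\<lambda>(x, D). map (\<lambda>b. (psi x + D) *v b) bs)"

definition sec_param :: "('a::{finite,field}^'n::finite^'m::finite) set \<Rightarrow> ('a list \<Rightarrow> 'a^'n^'m) \<Rightarrow> nat" where
  "sec_param C psi = (GREATEST mu. \<forall>bs. length bs = mu \<longrightarrow> leakage C psi bs = 0)"

end

theory Submission
  imports Defs "HOL-Algebra.Algebraic_Closure_Type" "HOL-Number_Theory.Residues"
begin

text \<open>Let \<open>q = |F|\<close> and \<open>N = max m n\<close>. Observing \<open>C B\<^sup>T\<close> leaks nothing iff every matrix agrees with some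
  codeword on the rows of \<open>B\<close>, i.e. iff the code restricts onto all linear maps from their span
  to \<open>F\<^sup>m\<close>.

  Let \<open>K\<close> be the extension of degree \<open>N\<close>. The linearized polynomials of \<open>q\<close>-degree below \<open>t\<close>
  over \<open>K\<close> interpolate arbitrary values at \<open>t\<close> independent points of \<open>K\<close>, so composing them with an
  embedding of \<open>F\<^sup>n\<close> into \<open>K\<close> and a projection of \<open>K\<close> onto \<open>F\<^sup>m\<close> gives a code of
  dimension at most \<open>N t\<close> that is secure against \<open>t\<close> observations, and so is every larger code. This
  projected Gabidulin code needs no duality theory and treats \<open>m \<le> n\<close> and \<open>n \<le> m\<close> alike.

  Conversely, a code of dimension below \<open>N (t + 1)\<close> is too small to be secure against \<open>t + 1\<close>
  observations: if \<open>N = m\<close>, it cannot take all values on \<open>t + 1\<close> unit vectors; if \<open>N = n\<close>, it is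
  orthogonal to a nonzero matrix supported on \<open>t + 1\<close> rows.\<close>

section \<open>Independence and mutual information of probability mass functions\<close>

text \<open>Countability makes the product sigma-algebra the full power set, so both sides have the
  same measurable sets.\<close>

lemma pair_measure_pmf:
  fixes p :: "'b::countable pmf" and q :: "'c::countable pmf"
  shows "measure_pmf p \<Otimes>\<^sub>M measure_pmf q = measure_pmf (pair_pmf p q)"
proof -
  have "sets (measure_pmf p \<Otimes>\<^sub>M measure_pmf q) = sets (count_space UNIV \<Otimes>\<^sub>M count_space UNIV)"
    by (rule sets_pair_measure_cong) simp_all
  also have "\<dots> = UNIV"
    by (subst pair_measure_countable) simp_all
  finally have s: "sets (measure_pmf p \<Otimes>\<^sub>M measure_pmf q) = UNIV" .
  show ?thesis
  proof (rule measure_eqI)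
    fix A assume "A \<in> sets (measure_pmf p \<Otimes>\<^sub>M measure_pmf q)"
    then have "emeasure (measure_pmf p \<Otimes>\<^sub>M measure_pmf q) A
        = (\<integral>\<^sup>+x. \<integral>\<^sup>+y. indicator A (x, y) \<partial>measure_pmf q \<partial>measure_pmf p)"
      by (rule measure_pmf.emeasure_pair_measure)
    also have "\<dots> = emeasure (measure_pmf (pair_pmf p q)) A"
      by (simp flip: nn_integral_pair_pmf')
    finally show "emeasure (measure_pmf p \<Otimes>\<^sub>M measure_pmf q) A
        = emeasure (measure_pmf (pair_pmf p q)) A" .
  qed (simp add: s)
qed

text \<open>Mutual information is the KL divergence of the joint law from the product of the
  marginals, which vanishes only when the two laws coincide. Finite support makes the entropy
  density integrable.\<close>

lemma mutual_information_pmf_eq_0_iff: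
  fixes U :: "'x \<Rightarrow> 'b::countable" and V :: "'x \<Rightarrow> 'c::countable"
  assumes fin: "finite (set_pmf p)" and b: "1 < b"
  shows "prob_space.mutual_information (measure_pmf p) b (count_space UNIV) (count_space UNIV) U V = 0
    \<longleftrightarrow> map_pmf (\<lambda>w. (U w, V w)) p = pair_pmf (map_pmf U p) (map_pmf V p)"
proof -
  define P where "P = pair_pmf (map_pmf U p) (map_pmf V p)"
  define Q where "Q = map_pmf (\<lambda>w. (U w, V w)) p"
  interpret P: information_space "measure_pmf P" b
    by (rule information_space.intro) (use b in \<open>auto simp: prob_space_measure_pmf information_space_axioms_def\<close>)
  have "distr (measure_pmf p) (count_space UNIV \<Otimes>\<^sub>M count_space UNIV) (\<lambda>w. (U w, V w)) = measure_pmf Q"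
    by (simp add: Q_def pair_measure_countable map_pmf_rep_eq)
  then have "prob_space.mutual_information (measure_pmf p) b (count_space UNIV) (count_space UNIV) U V
      = KL_divergence b (measure_pmf P) (measure_pmf Q)"
    unfolding prob_space.mutual_information_def[OF prob_space_measure_pmf]
    by (simp add: P_def pair_measure_pmf flip: map_pmf_rep_eq)
  also have "\<dots> = 0 \<longleftrightarrow> measure_pmf Q = measure_pmf P"
  proof (rule P.KL_eq_0_iff_eq_ac)
    show "prob_space (measure_pmf Q)" by (rule prob_space_measure_pmf)
    have "set_pmf Q \<subseteq> set_pmf P" by (auto simp: P_def Q_def)
    then show "absolutely_continuous (measure_pmf P) (measure_pmf Q)"
      unfolding absolutely_continuous_def null_sets_def
      by (auto simp: measure_pmf.emeasure_eq_measure measure_pmf_zero_iff)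
    show "integrable (measure_pmf Q) (entropy_density b (measure_pmf P) (measure_pmf Q))"
      by (rule integrable_measure_pmf_finite) (use fin in \<open>simp add: Q_def\<close>)
  qed simp
  also have "\<dots> \<longleftrightarrow> Q = P" by (simp add: measure_pmf_inject)
  finally show ?thesis by (simp add: P_def Q_def)
qed

section \<open>Secrecy as interpolation by codewords\<close>

text \<open>Neither the complement nor \<open>psi\<close> occurs here, so one computation of the
  security parameter serves every choice of them.\<close>

definition interpolates :: "('a::field^'n::finite^'m) set \<Rightarrow> ('a^'n) list \<Rightarrow> bool" where
  "interpolates C bs \<longleftrightarrow> (\<forall>A. \<exists>c\<in>C. \<forall>b\<in>set bs. A *v b = c *v b)"

lemma finite_msgs [simp]: "finite (msgs l :: 'a::finite list set)"
  using finite_lists_length_eq[of "UNIV :: 'a set" l] by (simp add: msgs_def)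

text \<open>Zero leakage means that message and observation are independent. Independence makes each
  observation that occurs at all possible for every message; conversely, interpolation lets the
  uniform codeword absorb the shift by \<open>psi x\<close>.\<close>

lemma leakage_eq_0_iff_interpolates:
  fixes C :: "('a::{finite,field}^'n::finite^'m::finite) set"
  assumes C: "mat.subspace C" and W: "is_complement C W"
    and psi: "is_lin_iso (info_param C) psi W"
  shows "leakage C psi bs = 0 \<longleftrightarrow> interpolates C bs"
proof -
  define M where "M = (msgs (info_param C) :: 'a list set)"
  define obs where "obs = (\<lambda>A :: 'a^'n^'m. map (\<lambda>b. A *v b) bs)"
  define p where "p = pair_pmf (pmf_of_set M) (pmf_of_set C)"
  define Y where "Y = (\<lambda>(x, D). obs (psi x + D))"
  have M: "finite M" "M \<noteq> {}"
    using Ex_list_of_length[of "info_param C"] by (auto simp: M_def) (auto simp: msgs_def)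
  have C0: "0 \<in> C" and finC: "finite C"
    using C by (auto simp: mat.subspace_def)
  have "C \<noteq> {}" using C0 by auto
  then have sp: "set_pmf p = M \<times> C"
    using M finC by (simp add: p_def)
  have fst: "map_pmf fst p = pmf_of_set M" by (simp add: p_def map_fst_pair_pmf)
  have psi_bij: "psi ` M = W"
    using psi by (simp add: is_lin_iso_def M_def bij_betw_def)
  have "leakage C psi bs = prob_space.mutual_information (measure_pmf p) 2
      (count_space UNIV) (count_space UNIV) fst Y"
    unfolding leakage_def p_def M_def Y_def obs_def ..
  moreover have "finite (set_pmf p)" by (simp add: sp M(1) finC)
  ultimately have "leakage C psi bs = 0 \<longleftrightarrow> map_pmf (\<lambda>w. (fst w, Y w)) p = pair_pmf (map_pmf fst p) (map_pmf Y p)"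
    using mutual_information_pmf_eq_0_iff[of p 2 fst Y] by simp
  also have "\<dots> \<longleftrightarrow> interpolates C bs"
  proof
    assume eq: "map_pmf (\<lambda>w. (fst w, Y w)) p = pair_pmf (map_pmf fst p) (map_pmf Y p)"
    show "interpolates C bs"
      unfolding interpolates_def
    proof
      fix A
      obtain c w where cw: "c \<in> C" "w \<in> W" "A = c + w"
        using W unfolding is_complement_def by blast
      from cw(2) obtain x where x: "x \<in> M" "psi x = w" using psi_bij by blast
      have "mat.subspace W" using W unfolding is_complement_def by blast
      then have "0 \<in> psi ` M" unfolding psi_bij by (rule mat.subspace_0)
      then obtain x0 where x0: "x0 \<in> M" "psi x0 = 0" by (metis imageE)
      \<comment> \<open>The message \<open>x0\<close> with codeword 0 yields the observation
        \<open>obs 0\<close>; by independence it must also occur with message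
        \<open>x\<close>.\<close>
      have "(x, obs 0) \<in> set_pmf (pair_pmf (map_pmf fst p) (map_pmf Y p))"
        using x x0 C0 M by (force simp: fst sp Y_def)
      then have "(x, obs 0) \<in> set_pmf (map_pmf (\<lambda>w. (fst w, Y w)) p)" by (simp add: eq)
      then obtain D where D: "D \<in> C" "obs 0 = obs (w + D)"
        using x by (auto simp: sp Y_def)
      have "A *v b = (c - D) *v b" if "b \<in> set bs" for b
        using D(2) that by (auto simp: obs_def cw(3) matrix_vector_mult_add_rdistrib
            matrix_vector_mult_diff_rdistrib eq_neg_iff_add_eq_0)
      then show "\<exists>c\<in>C. \<forall>b\<in>set bs. A *v b = c *v b"
        using mat.subspace_diff[OF C cw(1) D(1)] by blast
    qed
  next
    assume cov: "interpolates C bs"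
    define r where "r = map_pmf obs (pmf_of_set C)"
    \<comment> \<open>The observation has the same law for all messages: \<open>psi x\<close> can be
      traded for a codeword \<open>c\<close> with equal observations, and translation by
      \<open>c\<close> permutes \<open>C\<close>.\<close>
    have r: "map_pmf (\<lambda>D. obs (psi x + D)) (pmf_of_set C) = r" for x
    proof -
      obtain c where c: "c \<in> C" "\<And>b. b \<in> set bs \<Longrightarrow> psi x *v b = c *v b"
        using cov unfolding interpolates_def by meson
      have "map_pmf (\<lambda>D. obs (psi x + D)) (pmf_of_set C) = map_pmf obs (map_pmf ((+) c) (pmf_of_set C))"
        unfolding pmf.map_comp
        by (rule map_pmf_cong) (auto simp: obs_def matrix_vector_mult_add_rdistrib c(2))
      also have "map_pmf ((+) c) (pmf_of_set C) = pmf_of_set ((+) c ` C)"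
        by (rule map_pmf_of_set_inj) (use C0 finC in auto)
      also have "(+) c ` C = C"
        by (rule endo_inj_surj) (use C c(1) finC in \<open>auto simp: mat.subspace_def\<close>)
      finally show ?thesis by (simp add: r_def)
    qed
    have "map_pmf (\<lambda>w. (fst w, Y w)) p = bind_pmf (pmf_of_set M) (\<lambda>x. map_pmf (Pair x) (map_pmf (\<lambda>D. obs (psi x + D)) (pmf_of_set C)))"
      unfolding p_def pair_pmf_def map_bind_pmf pmf.map_comp
      by (simp add: map_pmf_def bind_assoc_pmf bind_return_pmf Y_def)
    also have "\<dots> = pair_pmf (pmf_of_set M) r"
      unfolding r by (simp add: pair_pmf_def map_pmf_def)
    finally have joint: "map_pmf (\<lambda>w. (fst w, Y w)) p = pair_pmf (pmf_of_set M) r" .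
    have "map_pmf Y p = map_pmf snd (map_pmf (\<lambda>w. (fst w, Y w)) p)"
      by (simp add: pmf.map_comp comp_def)
    also have "\<dots> = r" by (simp add: joint map_snd_pair_pmf)
    finally show "map_pmf (\<lambda>w. (fst w, Y w)) p = pair_pmf (map_pmf fst p) (map_pmf Y p)"
      by (simp add: joint fst)
  qed
  finally show ?thesis .
qed

section \<open>Counting in finite vector spaces\<close>

text \<open>Coordinates identify the span with the functions from \<open>B\<close> to the scalars.
  Later this converts cardinalities into dimensions.\<close>

lemma (in vector_space) card_span_independent:
  assumes "finite (UNIV :: 'a set)" "finite B" "independent B"
  shows "card (span B) = card (UNIV :: 'a set) ^ card B"
proof -
  let ?comb = "\<lambda>f. \<Sum>b\<in>B. f b *s b"
  have "bij_betw ?comb (B \<rightarrow>\<^sub>E UNIV) (span B)"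
  proof (rule bij_betwI')
    fix f g assume fg: "f \<in> B \<rightarrow>\<^sub>E (UNIV :: 'a set)" "g \<in> B \<rightarrow>\<^sub>E (UNIV :: 'a set)"
    show "?comb f = ?comb g \<longleftrightarrow> f = g"
    proof
      assume "?comb f = ?comb g"
      then have "(\<Sum>b\<in>B. (f b - g b) *s b) = 0"
        by (simp add: scale_left_diff_distrib sum_subtractf)
      then have "f b - g b = 0" if "b \<in> B" for b
        using independentD[OF assms(3,2) subset_refl, of "\<lambda>b. f b - g b"] that by blast
      then show "f = g" using fg by (intro PiE_ext[of f B _ g]) auto
    qed simp
  next
    fix f :: "'b \<Rightarrow> 'a"
    show "?comb f \<in> span B" by (intro span_sum span_scale span_base)
  next
    fix x assume "x \<in> span B"
    then obtain u where "x = ?comb u" using span_finite[OF assms(2)] by auto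
    then show "\<exists>f\<in>B \<rightarrow>\<^sub>E UNIV. x = ?comb f" by (intro bexI[of _ "restrict u B"]) auto
  qed
  then have "card (span B) = card (B \<rightarrow>\<^sub>E (UNIV :: 'a set))" by (simp add: bij_betw_same_card)
  also have "\<dots> = card (UNIV :: 'a set) ^ card B" using assms(2) by (simp add: card_PiE)
  finally show ?thesis .
qed

section \<open>Finite extensions inside the algebraic closure\<close>

definition ac_scale :: "'a::field \<Rightarrow> 'a alg_closure \<Rightarrow> 'a alg_closure" where
  "ac_scale c x = to_ac c * x"

interpretation ac: vector_space ac_scale
  by unfold_locales (simp_all add: ac_scale_def algebra_simps)

context
  fixes dummy :: "'a::{finite,field} itself"
begin


lemma two_le_q: "2 \<le> CARD('a)"
proof -
  have "card {0, 1 :: 'a} \<le> CARD('a)" by (rule card_mono) auto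
  then show ?thesis by simp
qed

text \<open>Multiplication by a nonzero \<open>a\<close> permutes the nonzero elements; comparing
  their products cancels to the power \<open>q - 1\<close> of \<open>a\<close> being 1.\<close>

lemma power_q_eq: "(a :: 'a) ^ CARD('a) = a"
proof (cases "a = 0")
  case False
  have "bij_betw ((*) a) (UNIV - {0}) (UNIV - {0})"
    using False by (intro bij_betw_byWitness[where f' = "\<lambda>x. x / a"]) auto
  then have "(\<Prod>x\<in>UNIV - {0}. a * x) = (\<Prod>x\<in>UNIV - {0}. x)"
    by (rule prod.reindex_bij_betw)
  then have "a ^ (CARD('a) - 1) = 1" by (simp add: prod.distrib card_Diff_singleton)
  then show ?thesis using two_le_q power_eq_if[of a "CARD('a)"] by simp
qed (use two_le_q in simp)

lemma to_ac_power_q [simp]: "to_ac (a :: 'a) ^ CARD('a) = to_ac a"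
  by (simp flip: to_ac_power add: power_q_eq)

text \<open>The polynomial \<open>x^q - x\<close> has at most \<open>q\<close> roots, and the ground
  field already supplies \<open>q\<close> of them.\<close>

lemma power_q_fixed_iff: "(x :: 'a alg_closure) ^ CARD('a) = x \<longleftrightarrow> x \<in> range to_ac"
proof -
  let ?p = "Polynomial.monom 1 CARD('a) - [:0, 1:] :: 'a alg_closure poly"
  let ?R = "{x. poly ?p x = 0}"
  have c: "Polynomial.coeff ?p CARD('a) = 1" using two_le_q by (simp add: coeff_pCons split: nat.split)
  then have p: "?p \<noteq> 0" by (metis coeff_0 zero_neq_one)
  have "Polynomial.degree ?p \<le> CARD('a)"
    by (rule degree_diff_le) (use two_le_q in \<open>auto simp: degree_monom_eq\<close>)
  then have "card ?R \<le> CARD('a)" using card_poly_roots_bound[OF p] by linarith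
  moreover have "card (range (to_ac :: 'a \<Rightarrow> _)) = CARD('a)"
    using card_image[OF inj_to_ac[where 'a='a]] by simp
  moreover have sub: "range to_ac \<subseteq> ?R" by (auto simp: poly_monom)
  ultimately have "range to_ac = ?R"
    by (intro card_seteq poly_roots_finite p) auto
  then show ?thesis by (auto simp: poly_monom set_eq_iff)
qed

text \<open>Both sides are monic polynomials of degree \<open>q\<close> in \<open>x\<close> that agree on the \<open>q\<close> elements of the
  ground field. Applying this twice gives additivity without knowing that \<open>q\<close> is a prime power.\<close>

lemma power_q_add_aux:
  fixes y :: "'a alg_closure"
  assumes "\<And>a. (to_ac a + y) ^ CARD('a) = to_ac a + y ^ CARD('a)"
  shows "(x + y) ^ CARD('a) = x ^ CARD('a) + y ^ CARD('a)"
proof -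
  have "[:y, 1:] ^ CARD('a) = Polynomial.monom 1 CARD('a) + [:y ^ CARD('a):]"
  proof (rule poly_eqI_degree_lead_coeff[where n = "CARD('a)" and A = "range to_ac"])
    have d: "Polynomial.degree ([:y, 1:] ^ CARD('a)) = CARD('a)" by (simp add: degree_power_eq)
    then show "Polynomial.degree ([:y, 1:] ^ CARD('a)) \<le> CARD('a)" by simp
    have "Polynomial.lead_coeff ([:y, 1:] ^ CARD('a)) = 1" by (simp only: lead_coeff_power) simp
    then show "Polynomial.coeff ([:y, 1:] ^ CARD('a)) CARD('a) = Polynomial.coeff (Polynomial.monom 1 CARD('a) + [:y ^ CARD('a):]) CARD('a)"
      using two_le_q by (simp add: d coeff_pCons split: nat.split)
    show "Polynomial.degree (Polynomial.monom 1 CARD('a) + [:y ^ CARD('a):]) \<le> CARD('a)"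
      by (rule degree_add_le) (simp_all add: degree_monom_eq)
    show "card (range (to_ac :: 'a \<Rightarrow> _)) \<ge> CARD('a)" using card_image[OF inj_to_ac[where 'a='a]] by simp
    show "poly ([:y, 1:] ^ CARD('a)) z = poly (Polynomial.monom 1 CARD('a) + [:y ^ CARD('a):]) z" if "z \<in> range to_ac" for z
      using that assms by (auto simp: poly_monom poly_power add.commute)
  qed
  from arg_cong[OF this, of "\<lambda>p. poly p x"] show ?thesis
    by (simp add: poly_monom poly_power add.commute)
qed

lemma power_q_add: "(x + y :: 'a alg_closure) ^ CARD('a) = x ^ CARD('a) + y ^ CARD('a)"
proof (rule power_q_add_aux)
  fix a :: 'a
  have "(x + to_ac a) ^ CARD('a) = x ^ CARD('a) + to_ac a ^ CARD('a)" for x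
    by (rule power_q_add_aux) (simp flip: to_ac_add)
  then show "(to_ac a + y) ^ CARD('a) = to_ac a + y ^ CARD('a)" by (metis add.commute to_ac_power_q)
qed

lemma power_q_power_Suc: "(x :: 'a alg_closure) ^ (CARD('a) ^ Suc i) = (x ^ (CARD('a) ^ i)) ^ CARD('a)"
  by (simp flip: power_mult add: mult.commute)

lemma power_q_power_add: "(x + y :: 'a alg_closure) ^ (CARD('a) ^ i) = x ^ (CARD('a) ^ i) + y ^ (CARD('a) ^ i)"
  by (induction i) (simp_all add: power_q_power_Suc power_q_add del: power_Suc)

lemma power_q_power_to_ac [simp]: "to_ac (a :: 'a) ^ (CARD('a) ^ i) = to_ac a"
  by (induction i) (simp_all add: power_q_power_Suc del: power_Suc)

lemma power_q_power_diff: "(x - y :: 'a alg_closure) ^ (CARD('a) ^ i) = x ^ (CARD('a) ^ i) - y ^ (CARD('a) ^ i)"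
  using power_q_power_add[of "x - y" y i] by (simp add: algebra_simps)

text \<open>The subfield with \<open>q ^ N\<close> elements if \<open>N > 0\<close>; for \<open>N = 0\<close> it is the whole closure.\<close>

definition subfield_deg :: "nat \<Rightarrow> 'a alg_closure set" where
  "subfield_deg N = {x. x ^ (CARD('a) ^ N) = x}"

lemma subfield_deg_closed:
  assumes "x \<in> subfield_deg N" "y \<in> subfield_deg N"
  shows "x + y \<in> subfield_deg N" "x - y \<in> subfield_deg N" "x * y \<in> subfield_deg N"
    "x / y \<in> subfield_deg N"
  using assms by (simp_all add: subfield_deg_def power_q_power_add power_q_power_diff
      power_mult_distrib power_divide)

lemma to_ac_subfield_deg [simp]: "to_ac a \<in> subfield_deg N"
  by (simp add: subfield_deg_def)

lemma zero_one_subfield_deg [simp]: "0 \<in> subfield_deg N" "1 \<in> subfield_deg N"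
  using two_le_q by (simp_all add: subfield_deg_def)

lemma power_subfield_deg: "x \<in> subfield_deg N \<Longrightarrow> x ^ k \<in> subfield_deg N"
  by (induction k) (simp_all add: subfield_deg_closed)

lemma sum_subfield_deg: "(\<And>i. i \<in> I \<Longrightarrow> f i \<in> subfield_deg N) \<Longrightarrow> sum f I \<in> subfield_deg N"
  by (induction I rule: infinite_finite_induct) (simp_all add: subfield_deg_closed)

lemma subspace_subfield_deg: "ac.subspace (subfield_deg N)"
  by (simp add: ac.subspace_def ac_scale_def subfield_deg_closed)

text \<open>The polynomial \<open>x^Q - x\<close> splits in the closure, and its derivative is -1,
  so its \<open>Q\<close> roots are distinct.\<close>

lemma card_subfield_deg:
  assumes "N > 0"
  shows "card (subfield_deg N) = CARD('a) ^ N"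
proof -
  define Q where "Q = CARD('a) ^ N"
  define p where "p = (Polynomial.monom 1 Q - [:0, 1:] :: 'a alg_closure poly)"
  have Q: "2 \<le> Q" using two_le_q self_le_power[of "CARD('a)" N] assms by (simp add: Q_def)
  have d: "Polynomial.degree p = Q" unfolding p_def using Q
    by (subst diff_conv_add_uminus, subst degree_add_eq_left) (auto simp: degree_monom_eq)
  have "p \<noteq> 0" using d Q by auto
  then obtain A where A: "size A = Polynomial.degree p" "p = Polynomial.smult (Polynomial.lead_coeff p) (\<Prod>x\<in>#A. [:-x, 1:])"
    using alg_closed_imp_factorization by blast
  have lc: "Polynomial.lead_coeff p \<noteq> 0" using \<open>p \<noteq> 0\<close> by simp
  \<comment> \<open>The characteristic divides \<open>q\<close>, hence also \<open>Q\<close> as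
    \<open>N > 0\<close>; this kills the derivative of the leading term.\<close>
  have "of_nat CARD('a) = (0 :: 'a)"
    using CHAR_dvd_CARD[where 'a='a] by (simp add: of_nat_eq_0_iff_char_dvd)
  then have "of_nat CARD('a) = (0 :: 'a alg_closure)" by (metis to_ac_of_nat to_ac_0)
  then have "of_nat Q = (0 :: 'a alg_closure)" using assms by (simp add: Q_def)
  then have pd: "pderiv p = [:-1:]"
    by (simp add: p_def pderiv_diff pderiv_monom pderiv_pCons)
  \<comment> \<open>A double root would also be a root of the derivative, a nonzero
    constant.\<close>
  have "count A x \<le> 1" for x
  proof (rule ccontr)
    assume "\<not> count A x \<le> 1"
    then have "replicate_mset 2 x \<subseteq># A" by (simp add: count_le_replicate_mset_subset_eq[symmetric])
    then obtain A' where A': "A = replicate_mset 2 x + A'" by (metis subset_mset.add_diff_inverse)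
    define r where "r = Polynomial.smult (Polynomial.lead_coeff p) (\<Prod>y\<in>#A'. [:-y, 1:])"
    have "p = [:-x, 1:] * ([:-x, 1:] * r)"
      by (subst A(2)) (simp add: A' r_def numeral_2_eq_2)
    then have "poly (pderiv p) x = 0" by (simp only: pderiv_mult) simp
    then show False by (simp add: pd)
  qed
  moreover have "count A x \<noteq> 0" if "x \<in># A" for x using that by simp
  ultimately have "count A x = 1" if "x \<in># A" for x using that by (metis le_antisym less_one not_le)
  then have "size A = card (set_mset A)"
    by (simp add: size_multiset_overloaded_eq)
  moreover have "set_mset A = {x. poly p x = 0}"
    using lc by (subst A(2)) (auto simp: poly_prod_mset prod_mset_zero_iff)
  moreover have "{x. poly p x = 0} = subfield_deg N"
    by (auto simp: p_def subfield_deg_def Q_def poly_monom)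
  ultimately show ?thesis using A(1) d by (simp add: Q_def)
qed

section \<open>Linearized polynomials\<close>

definition linpolys :: "nat \<Rightarrow> nat \<Rightarrow> ('a alg_closure \<Rightarrow> 'a alg_closure) set" where
  "linpolys N t = (\<lambda>c x. \<Sum>i<t. c i * x ^ (CARD('a) ^ i)) ` (UNIV \<rightarrow> subfield_deg N)"

lemma linpolysE:
  assumes "f \<in> linpolys N t"
  obtains c where "\<And>i. c i \<in> subfield_deg N" "f = (\<lambda>x. \<Sum>i<t. c i * x ^ (CARD('a) ^ i))"
proof -
  from assms obtain c where "f = (\<lambda>x. \<Sum>i<t. c i * x ^ (CARD('a) ^ i))" "c \<in> UNIV \<rightarrow> subfield_deg N"
    unfolding linpolys_def by (rule imageE)
  then show thesis by (intro that[of c]) (auto simp: Pi_iff)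
qed

lemma linpolysI:
  assumes "\<And>i. c i \<in> subfield_deg N" "\<And>x. f x = (\<Sum>i<t. c i * x ^ (CARD('a) ^ i))"
  shows "f \<in> linpolys N t"
  using assms by (auto simp: linpolys_def intro!: image_eqI[where x=c])

lemma linpolys_add:
  assumes "f \<in> linpolys N t" "g \<in> linpolys N t"
  shows "(\<lambda>x. f x + g x) \<in> linpolys N t"
proof -
  from assms(1) obtain c where c: "\<And>i. c i \<in> subfield_deg N" "f = (\<lambda>x. \<Sum>i<t. c i * x ^ (CARD('a) ^ i))"
    by (rule linpolysE) blast
  from assms(2) obtain d where d: "\<And>i. d i \<in> subfield_deg N" "g = (\<lambda>x. \<Sum>i<t. d i * x ^ (CARD('a) ^ i))"
    by (rule linpolysE) blast
  show ?thesis using c d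
    by (intro linpolysI[where c="\<lambda>i. c i + d i"])
      (auto simp: subfield_deg_closed sum.distrib algebra_simps)
qed

lemma linpolys_mult:
  assumes "f \<in> linpolys N t" "a \<in> subfield_deg N"
  shows "(\<lambda>x. a * f x) \<in> linpolys N t"
proof -
  obtain c where "\<And>i. c i \<in> subfield_deg N" "f = (\<lambda>x. \<Sum>i<t. c i * x ^ (CARD('a) ^ i))"
    using assms(1) by (rule linpolysE) blast
  then show ?thesis
    by (intro linpolysI[where c="\<lambda>i. a * c i"])
      (auto simp: subfield_deg_closed assms(2) sum_distrib_left algebra_simps)
qed

lemma linpolys_mono:
  assumes "f \<in> linpolys N s" "s \<le> t"
  shows "f \<in> linpolys N t"
proof -
  obtain c where c: "\<And>i. c i \<in> subfield_deg N" "f = (\<lambda>x. \<Sum>i<s. c i * x ^ (CARD('a) ^ i))"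
    using assms(1) by (rule linpolysE) blast
  have "(\<Sum>i<t. (if i < s then c i else 0) * x ^ (CARD('a) ^ i)) = (\<Sum>i<s. c i * x ^ (CARD('a) ^ i))" for x
    by (rule sum.mono_neutral_cong_right) (use assms(2) in auto)
  then show ?thesis
    by (intro linpolysI[where c="\<lambda>i. if i < s then c i else 0"]) (simp_all add: c)
qed

lemma power_q_sum: "(\<Sum>i\<in>I. g i :: 'a alg_closure) ^ CARD('a) = (\<Sum>i\<in>I. g i ^ CARD('a))"
  using two_le_q by (induction I rule: infinite_finite_induct) (simp_all add: power_q_add)

text \<open>Frobenius is additive, so it acts on the coefficients and moves each one place up,
  leaving 0 at index 0.\<close>

lemma linpolys_power_q:
  assumes "f \<in> linpolys N t"
  shows "(\<lambda>x. f x ^ CARD('a)) \<in> linpolys N (Suc t)"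
proof -
  obtain c where c: "\<And>i. c i \<in> subfield_deg N" "f = (\<lambda>x. \<Sum>i<t. c i * x ^ (CARD('a) ^ i))"
    using assms by (rule linpolysE) blast
  have "f x ^ CARD('a) = (\<Sum>i<Suc t. (if i = 0 then 0 else c (i - 1) ^ CARD('a)) * x ^ (CARD('a) ^ i))" for x
    by (simp add: sum.lessThan_Suc_shift c(2) power_q_sum power_mult_distrib power_q_power_Suc
        del: power_Suc sum.lessThan_Suc)
  then show ?thesis
    by (intro linpolysI[where c="\<lambda>i. if i = 0 then 0 else c (i - 1) ^ CARD('a)"])
      (auto simp: c(1) power_subfield_deg)
qed

lemma linpolys_linear:
  assumes "f \<in> linpolys N t"
  shows "f (x + y) = f x + f y" "f (ac_scale a x) = ac_scale a (f x)"
  using assms by (auto elim!: linpolysE simp: power_q_power_add distrib_left sum.distrib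
      ac_scale_def power_mult_distrib sum_distrib_left mult_ac)

lemma linpolys_in_subfield_deg:
  assumes "f \<in> linpolys N t" "x \<in> subfield_deg N"
  shows "f x \<in> subfield_deg N"
  using assms by (auto elim!: linpolysE intro!: sum_subfield_deg subfield_deg_closed power_subfield_deg)

text \<open>If \<open>M\<close> vanishes exactly on \<open>span S\<close>, then \<open>M\<^sup>q - M(u)\<^bsup>q-1\<^esup> M\<close> vanishes exactly where
  \<open>M(x) / M(u)\<close> is in the ground field, i.e. on \<open>span (insert u S)\<close>.\<close>

lemma linpolys_annihilator:
  assumes "finite S" "ac.independent S" "S \<subseteq> subfield_deg N"
  shows "\<exists>M\<in>linpolys N (Suc (card S)). \<forall>x. M x = 0 \<longleftrightarrow> x \<in> ac.span S"
  using assms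
proof (induction S)
  case empty
  have "(\<lambda>x. x) \<in> linpolys N (Suc 0)"
    by (rule linpolysI[where c="\<lambda>_. 1"]) auto
  then show ?case by (intro bexI) auto
next
  case (insert u S)
  then have ind: "ac.independent S" "u \<notin> ac.span S" by (auto simp: ac.independent_insert)
  obtain M where M: "M \<in> linpolys N (Suc (card S))" "\<And>x. M x = 0 \<longleftrightarrow> x \<in> ac.span S"
    using insert ind by auto
  have u: "u \<in> subfield_deg N" "M u \<noteq> 0" using insert.prems ind(2) M(2) by auto
  let ?M = "\<lambda>x. M x ^ CARD('a) + (- (M u ^ (CARD('a) - 1))) * M x"
  have "- (M u ^ (CARD('a) - 1)) \<in> subfield_deg N"
    using subfield_deg_closed(2)[of 0 N "M u ^ (CARD('a) - 1)"] linpolys_in_subfield_deg[OF M(1) u(1)]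
    by (simp add: power_subfield_deg)
  then have "?M \<in> linpolys N (Suc (Suc (card S)))"
    by (intro linpolys_add linpolys_power_q linpolys_mult M(1) linpolys_mono[OF M(1)]) auto
  moreover have "?M x = 0 \<longleftrightarrow> x \<in> ac.span (insert u S)" for x
  proof -
    have "M u ^ CARD('a) = M u ^ (CARD('a) - 1) * M u"
      using two_le_q power_eq_if[of "M u" "CARD('a)"] by (simp add: mult.commute)
    then have "(M x / M u) ^ CARD('a) = M x / M u
        \<longleftrightarrow> M x ^ CARD('a) / M u ^ (CARD('a) - 1) = M x"
      using u(2) by (simp add: power_divide field_simps)
    also have "\<dots> \<longleftrightarrow> ?M x = 0" using u(2) by (simp add: field_simps)
    finally have "?M x = 0 \<longleftrightarrow> (M x / M u) ^ CARD('a) = M x / M u" ..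
    also have "\<dots> \<longleftrightarrow> (\<exists>a. M x = to_ac a * M u)"
      using u(2) by (auto simp: power_q_fixed_iff image_iff divide_eq_eq)
    also have "\<dots> \<longleftrightarrow> (\<exists>a. M (x - ac_scale a u) = 0)"
    proof -
      have "M x = M (x - ac_scale a u) + to_ac a * M u" for a
        using linpolys_linear(1)[OF M(1), of "x - ac_scale a u" "ac_scale a u"]
          linpolys_linear(2)[OF M(1), of a u] by (simp add: ac_scale_def)
      then have "M x = to_ac a * M u \<longleftrightarrow> M (x - ac_scale a u) = 0" for a
        by (metis add_cancel_left_left)
      then show ?thesis by simp
    qed
    also have "\<dots> \<longleftrightarrow> x \<in> ac.span (insert u S)"
      by (simp add: M(2) ac.span_insert)
    finally show ?thesis .
  qed
  ultimately show ?case using insert.hyps by (intro bexI[of _ ?M]) auto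
qed

text \<open>Newton interpolation: the value at a new point \<open>u\<close> is corrected by a
  multiple of the annihilator of \<open>ac.span S\<close>, which vanishes on \<open>S\<close> but
  not at \<open>u\<close>.\<close>

lemma linpolys_interpolation:
  assumes "finite S" "ac.independent S" "S \<subseteq> subfield_deg N" "y \<in> S \<rightarrow> subfield_deg N"
  shows "\<exists>f\<in>linpolys N (card S). \<forall>u\<in>S. f u = y u"
  using assms
proof (induction S)
  case empty
  have "(\<lambda>x. 0) \<in> linpolys N 0"
    by (rule linpolysI[where c="\<lambda>_. 0"]) auto
  then show ?case by auto
next
  case (insert u S)
  then have ind: "ac.independent S" "u \<notin> ac.span S" by (auto simp: ac.independent_insert)
  obtain f where f: "f \<in> linpolys N (card S)" "\<And>v. v \<in> S \<Longrightarrow> f v = y v"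
    using insert ind by (auto simp: Pi_iff)
  obtain M where M: "M \<in> linpolys N (Suc (card S))" "\<And>x. M x = 0 \<longleftrightarrow> x \<in> ac.span S"
    using linpolys_annihilator[OF insert.hyps(1) ind(1), of N] insert.prems by auto
  have u: "u \<in> subfield_deg N" "y u \<in> subfield_deg N" "M u \<noteq> 0"
    using insert.prems ind(2) M(2) by auto
  let ?f = "\<lambda>x. f x + (y u - f u) / M u * M x"
  have "?f \<in> linpolys N (Suc (card S))"
    by (intro linpolys_add linpolys_mult subfield_deg_closed u linpolys_mono[OF f(1)] M(1)
        linpolys_in_subfield_deg[OF f(1)] linpolys_in_subfield_deg[OF M(1)]) auto
  moreover have "?f v = y v" if "v \<in> insert u S" for v
    using that u f(2) M(2)[of v] by (auto simp: ac.span_base)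
  ultimately show ?case using insert.hyps by (intro bexI[of _ ?f]) auto
qed


lemma card_linpolys_le:
  assumes "finite (subfield_deg N)"
  shows "finite (linpolys N t)" "card (linpolys N t) \<le> card (subfield_deg N) ^ t"
proof -
  let ?F = "\<lambda>c x. \<Sum>i<t. c i * x ^ (CARD('a) ^ i)"
  have sub: "linpolys N t \<subseteq> ?F ` ({..<t} \<rightarrow>\<^sub>E subfield_deg N)"
  proof
    fix f assume "f \<in> linpolys N t"
    then obtain c where c: "\<And>i. c i \<in> subfield_deg N" "f = ?F c" by (rule linpolysE) blast
    then have "f = ?F (restrict c {..<t})" by auto
    moreover have "restrict c {..<t} \<in> {..<t} \<rightarrow>\<^sub>E subfield_deg N" using c(1) by auto
    ultimately show "f \<in> ?F ` ({..<t} \<rightarrow>\<^sub>E subfield_deg N)" by (rule image_eqI)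
  qed
  have fin: "finite ({..<t} \<rightarrow>\<^sub>E subfield_deg N)" using assms by (intro finite_PiE) auto
  then show "finite (linpolys N t)" using sub finite_subset by blast
  have "card (linpolys N t) \<le> card ({..<t} \<rightarrow>\<^sub>E subfield_deg N)"
    using fin sub by (rule surj_card_le)
  then show "card (linpolys N t) \<le> card (subfield_deg N) ^ t" by (simp add: card_PiE)
qed

end


section \<open>Limits on the security of small codes\<close>

lemma CARD_matrix: "CARD('a::finite^'n::finite^'m::finite) = CARD('a) ^ (CARD('m) * CARD('n))"
  by (simp add: power_mult mult.commute flip: power_mult)

lemma interpolates_mono:
  assumes "interpolates C bs" "set bs' \<subseteq> set bs"
  shows "interpolates C bs'"
  using assms unfolding interpolates_def by (meson subsetD)

text \<open>Observing \<open>s\<close> unit vectors reveals \<open>s\<close> columns. These can be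
  prescribed arbitrarily, and interpolation would need a different codeword for each
  prescription.\<close>

lemma not_interpolates_columns:
  fixes C :: "('a::{finite,field}^'n::finite^'m::finite) set"
  assumes small: "card C < CARD('a) ^ (CARD('m) * s)" and s: "s \<le> CARD('n)"
  shows "\<exists>bs. length bs = s \<and> \<not> interpolates C bs"
proof -
  obtain S :: "'n set" where S: "card S = s" using obtain_subset_with_card_n[OF s] by blast
  obtain xs where xs: "set xs = S" "length xs = s"
    using finite_distinct_list[of S] S distinct_card by (metis finite_code)
  let ?bs = "map (\<lambda>j. axis j 1 :: 'a^'n) xs"
  have "\<not> interpolates C ?bs"
  proof
    assume int: "interpolates C ?bs"
    let ?\<Phi> = "\<lambda>c. \<lambda>j\<in>S. c *v axis j 1 :: 'a^'m"
    have "S \<rightarrow>\<^sub>E UNIV \<subseteq> ?\<Phi> ` C"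
    proof
      fix h :: "'n \<Rightarrow> 'a^'m" assume h: "h \<in> S \<rightarrow>\<^sub>E UNIV"
      let ?A = "\<chi> i j. h j $ i"
      obtain c where c: "c \<in> C" "\<forall>b\<in>set ?bs. ?A *v b = c *v b"
        using int unfolding interpolates_def by meson
      have A: "?A *v axis j 1 = h j" for j
        by (simp add: vec_eq_iff matrix_vector_mult_def axis_def if_distrib[of "\<lambda>x. _ * x"] cong: if_cong)
      have "h = ?\<Phi> c"
      proof
        fix j show "h j = ?\<Phi> c j"
          using h c(2) A[of j] by (cases "j \<in> S") (auto simp: xs(1) PiE_def extensional_def)
      qed
      then show "h \<in> ?\<Phi> ` C" using c(1) by (rule image_eqI)
    qed
    then have "card (S \<rightarrow>\<^sub>E (UNIV :: ('a^'m) set)) \<le> card C" by (intro surj_card_le) auto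
    then show False using small by (simp add: card_PiE S flip: power_mult)
  qed
  then show ?thesis using xs(2) by (intro exI[of _ ?bs]) simp
qed

text \<open>By pigeonhole some nonzero matrix supported on \<open>s\<close> rows is orthogonal to the code; a
  codeword observed along these \<open>s\<close> rows satisfies a nontrivial linear relation.\<close>

lemma not_interpolates_rows:
  fixes C :: "('a::{finite,field}^'n::finite^'m::finite) set"
  assumes C: "mat.subspace C"
    and small: "card C < CARD('a) ^ (CARD('n) * s)" and s: "s \<le> CARD('m)"
  shows "\<exists>bs. length bs = s \<and> \<not> interpolates C bs"
proof -
  obtain R :: "'m set" where R: "card R = s" using obtain_subset_with_card_n[OF s] by blast
  obtain xs where xs: "set xs = R" "length xs = s"
    using finite_distinct_list[of R] R distinct_card by (metis finite_code)
  obtain B where B: "B \<subseteq> C" "mat.independent B" "C \<subseteq> mat.span B"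
    using mat.maximal_independent_subset[of C] by blast
  have spB: "mat.span B = C" using B C by (intro antisym mat.span_minimal) auto
  have cB: "card C = CARD('a) ^ card B"
    using mat.card_span_independent[OF _ _ B(2)] by (simp add: spB)
  \<comment> \<open>This is the trace form of \<open>A\<close> with the matrix whose rows are
    \<open>h i\<close> for \<open>i\<close> in \<open>R\<close> and zero elsewhere. Testing it on
    the basis \<open>B\<close> alone leaves only \<open>card C\<close> possible outcomes.\<close>
  let ?\<phi> = "\<lambda>h A. \<Sum>i\<in>R. (A *v (h i :: 'a^'n)) $ i"
  let ?\<Phi> = "\<lambda>h. \<lambda>A\<in>B. ?\<phi> h A"
  have "card (R \<rightarrow>\<^sub>E (UNIV :: ('a^'n) set)) > card (B \<rightarrow>\<^sub>E (UNIV :: 'a set))"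
    using small by (simp add: card_PiE R cB flip: power_mult)
  moreover have "?\<Phi> ` (R \<rightarrow>\<^sub>E UNIV) \<subseteq> B \<rightarrow>\<^sub>E UNIV" by auto
  moreover have "finite (B \<rightarrow>\<^sub>E (UNIV :: 'a set))" by (intro finite_PiE) auto
  ultimately have "\<not> inj_on ?\<Phi> (R \<rightarrow>\<^sub>E UNIV)"
    by (meson card_inj_on_le not_le)
  then obtain h h' where h: "h \<in> R \<rightarrow>\<^sub>E UNIV" "h' \<in> R \<rightarrow>\<^sub>E UNIV" "h \<noteq> h'" "?\<Phi> h = ?\<Phi> h'"
    unfolding inj_on_def by blast
  define d where "d = (\<lambda>i. h i - h' i)"
  have "?\<phi> d A = 0" if "A \<in> B" for A
    using fun_cong[OF h(4), of A] that
    by (simp add: d_def matrix_vector_mult_diff_distrib sum_subtractf)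
  then have "B \<subseteq> {A. ?\<phi> d A = 0}" by blast
  moreover have "mat.subspace {A. ?\<phi> d A = 0}"
  proof -
    have "mat_scale c A *v v = c *s (A *v v)" for c and A :: "'a^'n^'m" and v
      by (simp add: mat_scale_def vec_eq_iff matrix_vector_mult_def sum_distrib_left mult.assoc)
    then show ?thesis
      by (simp add: mat.subspace_def matrix_vector_mult_add_rdistrib sum.distrib flip: sum_distrib_left)
  qed
  ultimately have vanish: "?\<phi> d c = 0" if "c \<in> C" for c
    using that mat.span_minimal[of B] spB by blast
  obtain i0 where i0: "i0 \<in> R" "d i0 \<noteq> 0"
    using h(1-3) PiE_ext[of h R _ h'] unfolding d_def by (metis eq_iff_diff_eq_0)
  then obtain j0 where j0: "d i0 $ j0 \<noteq> 0" by (auto simp: vec_eq_iff)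
  \<comment> \<open>A matrix unit at a nonzero entry of \<open>d\<close>: its pairing with
    \<open>d\<close> is that entry, whereas every codeword pairs to 0.\<close>
  let ?A = "(\<chi> i j. if i = i0 \<and> j = j0 then 1 else 0) :: 'a^'n^'m"
  have "(?A *v v) $ i = (if i = i0 then v $ j0 else 0)" for v i
    by (simp add: matrix_vector_mult_def if_distrib[of "\<lambda>x. x * _"] cong: if_cong)
  then have A: "?\<phi> d ?A = d i0 $ j0" using i0(1) by simp
  have "\<not> interpolates C (map d xs)"
  proof
    assume "interpolates C (map d xs)"
    then obtain c where c: "c \<in> C" "\<forall>b\<in>set (map d xs). ?A *v b = c *v b"
      unfolding interpolates_def by meson
    then have "?\<phi> d ?A = ?\<phi> d c" by (intro sum.cong) (auto simp: xs(1))
    then show False using A vanish[OF c(1)] j0 by simp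
  qed
  then show ?thesis using xs(2) by (intro exI[of _ "map d xs"]) simp
qed

text \<open>Padding \<open>bs0\<close> with zero rows carries the failure at \<open>Suc t\<close> to
  every larger number of observations, so \<open>t\<close> is an upper bound and the greatest value
  exists.\<close>

lemma sec_param_eqI:
  fixes C :: "('a::{finite,field}^'n::finite^'m::finite) set"
  assumes C: "mat.subspace C" "is_complement C W" "is_lin_iso (info_param C) psi W"
    and lower: "\<And>bs. length bs = t \<Longrightarrow> interpolates C bs"
    and upper: "length bs0 = Suc t" "\<not> interpolates C bs0"
  shows "sec_param C psi = t"
  unfolding sec_param_def leakage_eq_0_iff_interpolates[OF C]
proof (rule Greatest_equality)
  show "\<forall>bs. length bs = t \<longrightarrow> interpolates C bs" using lower by blast
  fix \<mu> assume \<mu>: "\<forall>bs. length bs = \<mu> \<longrightarrow> interpolates C bs"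
  show "\<mu> \<le> t"
  proof (rule ccontr)
    assume "\<not> \<mu> \<le> t"
    then have "interpolates C (bs0 @ replicate (\<mu> - Suc t) 0)" using \<mu> upper(1) by simp
    then show False using upper(2) by (auto dest: interpolates_mono)
  qed
qed

section \<open>Projected Gabidulin codes\<close>

text \<open>Linearized polynomials give a code of dimension at most \<open>N * t\<close>; the exact
  dimension \<open>d\<close> is then reached by enlarging it, which preserves interpolation.\<close>

lemma exists_interpolating_code:
  fixes dummy :: "'a::{finite,field} itself" and dummy2 :: "'m::finite itself"
    and dummy3 :: "'n::finite itself"
  assumes N: "N = max CARD('m) CARD('n)" and d: "N * t \<le> d" "d \<le> CARD('m) * CARD('n)"
  shows "\<exists>C :: ('a^'n^'m) set. mat.subspace C \<and> mat.dim C = d \<and> card C = CARD('a) ^ d \<and>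
    (\<forall>bs. length bs = t \<longrightarrow> interpolates C bs)"
proof -
  let ?K = "subfield_deg N :: 'a alg_closure set"
  have q2: "2 \<le> CARD('a)" by (rule two_le_q)
  have Npos: "N > 0" by (simp add: N less_max_iff_disj)
  have cK: "card ?K = CARD('a) ^ N" using card_subfield_deg[OF Npos] .
  then have finK: "finite ?K" by (intro card_ge_0_finite) (use q2 in simp)
  obtain B where B: "B \<subseteq> ?K" "ac.independent B" "?K \<subseteq> ac.span B"
    using ac.maximal_independent_subset[of ?K] by blast
  have finB: "finite B" using B(1) finK finite_subset by blast
  have "ac.span B = ?K"
    using B subspace_subfield_deg by (intro antisym ac.span_minimal) auto
  then have "CARD('a) ^ card B = CARD('a) ^ N"
    using ac.card_span_independent[OF _ finB B(2)] cK by simp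
  then have cB: "card B = N" using q2 by (simp add: power_inject_exp)
  \<comment> \<open>Coordinates with respect to a basis of the whole closure are linear everywhere,
    with no membership conditions.\<close>
  define E where "E = ac.extend_basis B"
  have E: "ac.independent E" "ac.span E = UNIV" "B \<subseteq> E"
    using B(2) by (simp_all add: E_def ac.independent_extend_basis ac.extend_basis_superset)
  define rep where "rep = ac.representation E"
  have rep: "rep (x + y) b = rep x b + rep y b" "rep (ac_scale a x) b = a * rep x b"
    "b \<in> E \<Longrightarrow> rep b b' = (if b' = b then 1 else 0)" for x y b b' a
    using E by (simp_all add: rep_def ac.representation_add ac.representation_scale
        ac.representation_basis)
  have rep_0: "rep 0 b = 0" for b using rep(2)[of 0 0 b] by simp
  have rep_sum: "rep (sum f I) b = (\<Sum>i\<in>I. rep (f i) b)" for f :: "_ \<Rightarrow> _" and I b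
    by (induction I rule: infinite_finite_induct) (simp_all add: rep rep_0)
  \<comment> \<open>As \<open>N\<close> is the maximum, \<open>B\<close> has room for both index
    types, whichever is larger.\<close>
  obtain \<beta> :: "'n \<Rightarrow> _" where \<beta>: "inj \<beta>" "range \<beta> \<subseteq> B"
    using card_le_inj[of "UNIV :: 'n set" B] finB cB N by auto
  obtain \<gamma> :: "'m \<Rightarrow> _" where \<gamma>: "inj \<gamma>" "range \<gamma> \<subseteq> B"
    using card_le_inj[of "UNIV :: 'm set" B] finB cB N by auto
  define emb where "emb = (\<lambda>v::'a^'n. \<Sum>j\<in>UNIV. ac_scale (v $ j) (\<beta> j))"
  define emb' where "emb' = (\<lambda>v::'a^'m. \<Sum>i\<in>UNIV. ac_scale (v $ i) (\<gamma> i))"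
  define prj where "prj = (\<lambda>x. (\<chi> j. rep x (\<beta> j)) :: 'a^'n)"
  define prj' where "prj' = (\<lambda>x. (\<chi> i. rep x (\<gamma> i)) :: 'a^'m)"
  have prj_emb: "prj (emb v) = v" for v
  proof -
    have "\<beta> j \<in> E" for j using \<beta>(2) E(3) by blast
    then have "rep (\<beta> j) (\<beta> k) = (if j = k then 1 else 0)" for j k
      by (simp add: rep(3) inj_eq[OF \<beta>(1)] eq_commute)
    then show ?thesis
      by (simp add: prj_def emb_def vec_eq_iff rep_sum rep(2) if_distrib[of "\<lambda>x. _ * x"] cong: if_cong)
  qed
  have prj_emb': "prj' (emb' v) = v" for v
  proof -
    have "\<gamma> j \<in> E" for j using \<gamma>(2) E(3) by blast
    then have "rep (\<gamma> j) (\<gamma> k) = (if j = k then 1 else 0)" for j k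
      by (simp add: rep(3) inj_eq[OF \<gamma>(1)] eq_commute)
    then show ?thesis
      by (simp add: prj'_def emb'_def vec_eq_iff rep_sum rep(2) if_distrib[of "\<lambda>x. _ * x"] cong: if_cong)
  qed
  have emb_K: "emb v \<in> ?K" for v
    using \<beta>(2) B(1) unfolding emb_def
    by (intro ac.subspace_sum[OF subspace_subfield_deg] ac.subspace_scale[OF subspace_subfield_deg]) auto
  have emb'_K: "emb' v \<in> ?K" for v
    using \<gamma>(2) B(1) unfolding emb'_def
    by (intro ac.subspace_sum[OF subspace_subfield_deg] ac.subspace_scale[OF subspace_subfield_deg]) auto

  \<comment> \<open>For linearized \<open>f\<close>, this is the matrix of \<open>emb\<close>
    followed by \<open>f\<close> and then \<open>prj'\<close>.\<close>
  define code where "code = (\<lambda>f. (\<chi> i j. rep (f (\<beta> j)) (\<gamma> i)) :: 'a^'n^'m)"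
  have code_mult: "code f *v v = prj' (f (emb v))" if f: "f \<in> linpolys N t" for f v
  proof -
    have "f 0 = 0" using linpolys_linear(2)[OF f, of 0 0] by (simp add: ac_scale_def)
    then have "f (sum g I) = (\<Sum>i\<in>I. f (g i))" for g :: "'n \<Rightarrow> _" and I
      by (induction I rule: infinite_finite_induct) (simp_all add: linpolys_linear(1)[OF f])
    then show ?thesis
      by (simp add: code_def emb_def prj'_def vec_eq_iff matrix_vector_mult_def rep_sum
          linpolys_linear(2)[OF f] rep(2) mult.commute)
  qed
  let ?C0 = "code ` linpolys N t"
  have sub: "mat.subspace ?C0"
  proof (rule mat.subspaceI)
    have "(\<lambda>x. 0) \<in> linpolys N t" by (rule linpolysI[where c="\<lambda>_. 0"]) auto
    moreover have "0 = code (\<lambda>x. 0)" by (simp add: code_def vec_eq_iff rep_0)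
    ultimately show "0 \<in> ?C0" by (intro image_eqI)
  next
    fix A A' assume "A \<in> ?C0" "A' \<in> ?C0"
    then obtain f g where fg: "A = code f" "A' = code g" "f \<in> linpolys N t" "g \<in> linpolys N t" by blast
    have "A + A' = code (\<lambda>x. f x + g x)" by (simp add: fg code_def vec_eq_iff rep)
    then show "A + A' \<in> ?C0" using linpolys_add[OF fg(3,4)] by (rule image_eqI)
  next
    fix a A assume "A \<in> ?C0"
    then obtain f where f: "A = code f" "f \<in> linpolys N t" by blast
    have "mat_scale a A = code (\<lambda>x. to_ac a * f x)"
      by (simp add: f code_def vec_eq_iff rep mat_scale_def flip: ac_scale_def)
    then show "mat_scale a A \<in> ?C0" using linpolys_mult[OF f(2) to_ac_subfield_deg] by (rule image_eqI)
  qed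
  obtain B0 where B0: "B0 \<subseteq> ?C0" "mat.independent B0" "?C0 \<subseteq> mat.span B0"
    using mat.maximal_independent_subset[of ?C0] by blast
  have "mat.span B0 = ?C0" using B0 sub by (intro antisym mat.span_minimal) auto
  then have "CARD('a) ^ card B0 = card ?C0"
    using mat.card_span_independent[OF _ _ B0(2)] by simp
  also have "\<dots> \<le> card (linpolys N t :: ('a alg_closure \<Rightarrow> _) set)"
    by (rule card_image_le) (rule card_linpolys_le(1)[OF finK])
  also have "\<dots> \<le> card ?K ^ t" by (rule card_linpolys_le(2)[OF finK])
  also have "\<dots> = CARD('a) ^ (N * t)" by (simp add: cK power_mult)
  finally have "card B0 \<le> N * t" using q2 by (simp add: power_increasing_iff)
  then have B0d: "card B0 \<le> d" using d(1) by simp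
  obtain B1 where B1: "B0 \<subseteq> B1" "mat.independent B1" "mat.span B1 = UNIV"
    using mat.extend_basis_superset[OF B0(2)] mat.independent_extend_basis[OF B0(2)]
      mat.span_extend_basis[OF B0(2)] by (rule that)
  have "CARD('a) ^ card B1 = CARD('a) ^ (CARD('m) * CARD('n))"
    using mat.card_span_independent[OF _ _ B1(2)] B1(3) CARD_matrix[where 'a='a and 'n='n and 'm='m] by simp
  then have "card B1 = CARD('m) * CARD('n)" using q2 by (simp add: power_inject_exp)
  \<comment> \<open>Choosing \<open>B2\<close> between a basis of \<open>?C0\<close> and a basis of
    the whole space fixes the dimension while keeping \<open>?C0\<close> inside the span.\<close>
  then obtain B2 where B2: "B0 \<subseteq> B2" "B2 \<subseteq> B1" "card B2 = d"
    using exists_subset_between[OF B0d _ B1(1)] d(2) by auto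
  have ind2: "mat.independent B2" using B1(2) B2(2) by (rule mat.independent_mono)
  have "interpolates (mat.span B2) bs" if bs: "length bs = t" for bs
    unfolding interpolates_def
  proof
    fix A :: "'a^'n^'m"
    \<comment> \<open>The observed vectors may be dependent, so interpolation happens on a maximal
      independent subset and linearity extends it to the others.\<close>
    obtain S where S: "S \<subseteq> emb ` set bs" "ac.independent S" "emb ` set bs \<subseteq> ac.span S"
      using ac.maximal_independent_subset[of "emb ` set bs"] by blast
    have finS: "finite S" using S(1) finite_subset by blast
    have "card S \<le> card (emb ` set bs)" using S(1) by (intro card_mono) auto
    also have "\<dots> \<le> t" using bs card_image_le[of "set bs" emb] card_length[of bs] by simp
    finally have cS: "card S \<le> t" .
    \<comment> \<open>The desired image is lifted into \<open>?K\<close> by \<open>emb'\<close>,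
      which \<open>prj'\<close> undoes afterwards.\<close>
    obtain f where f: "f \<in> linpolys N (card S)" "\<forall>u\<in>S. f u = emb' (A *v prj u)"
      using linpolys_interpolation[OF finS S(2), of N "\<lambda>u. emb' (A *v prj u)"] S(1) emb_K emb'_K
      by blast
    have ft: "f \<in> linpolys N t" using f(1) cS by (rule linpolys_mono)
    have eq: "prj' (f x) = A *v prj x" if "x \<in> ac.span S" for x
      using that
    proof (rule ac.span_induct)
      show "ac.subspace {x. prj' (f x) = A *v prj x}"
      proof (rule ac.subspaceI)
        have "f 0 = 0" using linpolys_linear(2)[OF ft, of 0 0] by (simp add: ac_scale_def)
        then show "0 \<in> {x. prj' (f x) = A *v prj x}"
          by (simp add: prj_def prj'_def rep_0 vec_eq_iff matrix_vector_mult_def)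
      next
        fix x y assume "x \<in> {x. prj' (f x) = A *v prj x}" "y \<in> {x. prj' (f x) = A *v prj x}"
        moreover have "prj' (u + v) = prj' u + prj' v" "prj (u + v) = prj u + prj v" for u v
          by (simp_all add: prj_def prj'_def rep vec_eq_iff)
        ultimately show "x + y \<in> {x. prj' (f x) = A *v prj x}"
          by (simp add: linpolys_linear(1)[OF ft] matrix_vector_right_distrib)
      next
        fix a x assume "x \<in> {x. prj' (f x) = A *v prj x}"
        moreover have "prj' (ac_scale a u) = a *s prj' u" "prj (ac_scale a u) = a *s prj u" for u
          by (simp_all add: prj_def prj'_def rep vec_eq_iff)
        ultimately show "ac_scale a x \<in> {x. prj' (f x) = A *v prj x}"
          by (simp add: linpolys_linear(2)[OF ft] vector_scalar_commute)
      qed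
    qed (use f(2) prj_emb' in simp)
    have "A *v b = code f *v b" if "b \<in> set bs" for b
      using eq[of "emb b"] that S(3) by (auto simp: code_mult[OF ft] prj_emb)
    moreover have "code f \<in> mat.span B2"
      using ft \<open>mat.span B0 = ?C0\<close> mat.span_mono[OF B2(1)] by blast
    ultimately show "\<exists>c\<in>mat.span B2. \<forall>b\<in>set bs. A *v b = c *v b" by blast
  qed
  moreover have "mat.dim (mat.span B2) = d" using ind2 B2(3) by (simp add: mat.dim_eq_card_independent)
  moreover have "card (mat.span B2) = CARD('a) ^ d"
    using mat.card_span_independent[OF _ _ ind2] B2(3) by simp
  ultimately show ?thesis by (intro exI[of _ "mat.span B2"]) auto
qed

section \<open>Choice of the parameters\<close>

text \<open>Dimension \<open>d = m * n - l\<close> satisfies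
  \<open>N * t \<le> d < N * Suc t\<close> for the claimed \<open>t\<close>: the left bound allows
  security against \<open>t\<close> observations, the right one excludes
  \<open>t + 1\<close>.\<close>

lemma exists_code_with_parameters:
  fixes dummy :: "'a::{finite,field} itself" and dummy2 :: "'m::finite itself"
    and dummy3 :: "'n::finite itself"
  defines "m \<equiv> CARD('m)" and "n \<equiv> CARD('n)"
  assumes l: "1 \<le> l" "l \<le> m * n"
  shows "\<exists>C :: ('a^'n^'m) set. linear_code C \<and> C \<noteq> UNIV \<and> info_param C = l \<and>
    (\<forall>W psi. is_complement C W \<and> is_lin_iso (info_param C) psi W \<longrightarrow>
      sec_param C psi = min m n - nat \<lceil>real l / real (max m n)\<rceil>)"
proof -
  define N where "N = max m n"
  define M where "M = min m n"
  define k where "k = nat \<lceil>real l / real N\<rceil>"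
  have Npos: "N > 0" by (simp add: N_def m_def less_max_iff_disj)
  have NM: "N * M = m * n" by (simp add: N_def M_def max_def min_def mult.commute)
  have "real l / real N \<le> real k" unfolding k_def by (rule real_nat_ceiling_ge)
  then have "real l \<le> real (N * k)" using Npos by (simp add: field_simps)
  \<comment> \<open>The ceiling enters only through \<open>l \<le> N * k < l + N\<close>.\<close>
  then have lk: "l \<le> N * k" by (simp only: of_nat_le_iff)
  have kpos: "k \<ge> 1" using lk l(1) by (cases k) auto
  have "real k < real l / real N + 1"
    unfolding k_def using Npos by (simp add: ceiling_less_iff nat_less_real_le) linarith
  then have "real (N * k) < real (l + N)" using Npos by (simp add: field_simps)
  then have kl: "N * k < l + N" by (simp only: of_nat_less_iff)
  \<comment> \<open>This ensures that the natural subtraction \<open>M - k\<close> is not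
    truncated.\<close>
  have "N * k < N * (M + 1)" using kl l(2) by (simp add: NM[symmetric])
  then have kM: "k \<le> M" by (simp only: mult_less_cancel1) simp
  define t where "t = M - k"
  have M: "M = t + k" using kM by (simp add: t_def)
  define d where "d = m * n - l"
  have d1: "N * t \<le> d" using lk unfolding d_def NM[symmetric] M by (simp add: algebra_simps)
  have d2: "d < N * Suc t" using kl l Npos unfolding d_def NM[symmetric] M by (simp add: algebra_simps)
  obtain C :: "('a^'n^'m) set" where C: "mat.subspace C" "mat.dim C = d" "card C = CARD('a) ^ d"
    "\<And>bs. length bs = t \<Longrightarrow> interpolates C bs"
    using exists_interpolating_code[where 'a='a and 'm='m and 'n='n, of N t d] d1
    by (auto simp: N_def m_def n_def d_def)
  have q2: "2 \<le> CARD('a)" by (rule two_le_q)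
  have small: "card C < CARD('a) ^ (N * Suc t)"
    unfolding C(3) using d2 q2 by (intro power_strict_increasing) auto
  \<comment> \<open>Since \<open>k\<close> is positive, there are enough rows and columns to choose
    \<open>t + 1\<close> of either.\<close>
  have tM: "Suc t \<le> M" using kpos M by simp
  have "\<exists>bs. length bs = Suc t \<and> \<not> interpolates C bs"
  proof (cases "m \<ge> n")
    case True
    then show ?thesis using small tM
      by (intro not_interpolates_columns) (auto simp: N_def M_def m_def n_def max_def)
  next
    case False
    then show ?thesis using small tM
      by (intro not_interpolates_rows C(1)) (auto simp: N_def M_def m_def n_def max_def)
  qed
  then obtain bs where bs: "length bs = Suc t" "\<not> interpolates C bs" by blast
  have "C \<noteq> UNIV" using bs(2) by (auto simp: interpolates_def)
  moreover have "info_param C = l"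
    unfolding info_param_def C(2) using l(2) by (simp add: d_def m_def n_def)
  moreover have "sec_param C psi = t" if "is_complement C W" "is_lin_iso (info_param C) psi W" for W psi
    using C(1) that C(4) bs by (rule sec_param_eqI)
  ultimately show ?thesis
    using C(1) by (intro exI[of _ C]) (auto simp: linear_code_def t_def M_def k_def N_def)
qed

theorem theorem2:
  fixes dummy :: "'a::{finite,field} itself" and dummy2 :: "'m::finite itself"
    and dummy3 :: "'n::finite itself"
  defines "m \<equiv> CARD('m)" and "n \<equiv> CARD('n)"
  shows "(\<forall>l::nat. 1 \<le> l \<and> l \<le> m * n \<longrightarrow>
            (\<exists>C :: ('a^'n^'m) set. linear_code C \<and> C \<noteq> UNIV \<and> info_param C = l \<and>
               (\<forall>W psi. is_complement C W \<and> is_lin_iso (info_param C) psi W \<longrightarrow>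
                  sec_param C psi = min m n - nat \<lceil>real l / real (max m n)\<rceil>)))
       \<and> (\<forall>t::nat. 1 \<le> t \<and> t \<le> min m n - 1 \<longrightarrow>
            (\<exists>C :: ('a^'n^'m) set. linear_code C \<and> C \<noteq> UNIV \<and>
               info_param C = max m n * (min m n - t) \<and>
               (\<forall>W psi. is_complement C W \<and> is_lin_iso (info_param C) psi W \<longrightarrow>
                  sec_param C psi = t)))"
proof (intro conjI allI impI)
  fix l assume "1 \<le> l \<and> l \<le> m * n"
  then show "\<exists>C :: ('a^'n^'m) set. linear_code C \<and> C \<noteq> UNIV \<and> info_param C = l \<and>
      (\<forall>W psi. is_complement C W \<and> is_lin_iso (info_param C) psi W \<longrightarrow>
        sec_param C psi = min m n - nat \<lceil>real l / real (max m n)\<rceil>)"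
    unfolding m_def n_def by (intro exists_code_with_parameters) auto
next
  fix t assume t: "1 \<le> t \<and> t \<le> min m n - 1"
  let ?l = "max m n * (min m n - t)"
  have pos: "max m n > 0" by (simp add: m_def less_max_iff_disj)
  have "?l \<le> max m n * min m n" by (intro mult_le_mono2 diff_le_self)
  also have "\<dots> = m * n" by (simp add: max_def min_def mult.commute)
  finally have l: "1 \<le> ?l" "?l \<le> m * n" using t pos by auto
  \<comment> \<open>The quotient is an integer here, so the ceiling is exact and the second claim
    becomes an instance of the first construction.\<close>
  have "real ?l / real (max m n) = real (min m n - t)"
    using pos by (simp only: of_nat_mult) simp
  then have "min m n - nat \<lceil>real ?l / real (max m n)\<rceil> = min m n - (min m n - t)"
    by (simp only: ceiling_of_nat nat_int)
  also have "\<dots> = t" using t by (intro diff_diff_cancel) linarith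
  finally show "\<exists>C :: ('a^'n^'m) set. linear_code C \<and> C \<noteq> UNIV \<and> info_param C = ?l \<and>
      (\<forall>W psi. is_complement C W \<and> is_lin_iso (info_param C) psi W \<longrightarrow> sec_param C psi = t)"
    using exists_code_with_parameters[where 'a='a and 'm='m and 'n='n, OF l[unfolded m_def n_def]]
    by (simp only: m_def n_def)
qed

end
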